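(* Let $G$ be a finite simple connected regular graph with at least one edge. Then $es_{\chi'}(G)=1$ if and only if $G$ is isomorphic to $K_{2}$ or to a cycle $C_n$ with $n$ odd.
   Context: All graphs are finite, simple and have at least one edge. $\chi'(G)$ is the chromatic index of $G$. The chromatic edge stability index $es_{\chi'}(G)$ is the minimum cardinality of a set of edges $F\subseteq E(G)$ such that $\chi'(G\setminus F)<\chi'(G)$, where $G\setminus F$ is $G$ with the edges of $F$ deleted (all vertices are kept; an edgeless graph has chromatic index $0$). $K_2$ is the complete graph of order $2$ and $C_n$ ($n\ge 3$) is the cycle of order $n$. *)

theory Defs
  imports Main
begin

text \<open>
  Undirected graphs are given by an explicit vertex set and a set of edges, an edge being the
  two-element set of its endpoints. The predicate \<open>simple_graph\<close> imposes finiteness and rules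
  out loops; parallel edges cannot be represented.
\<close>

record 'a ugraph =
  verts :: "'a set"
  edges :: "'a set set"

definition simple_graph :: "'a ugraph \<Rightarrow> bool" where
  "simple_graph G \<longleftrightarrow> finite (verts G) \<and> (\<forall>e\<in>edges G. e \<subseteq> verts G \<and> card e = 2)"

definition adj_rel :: "'a ugraph \<Rightarrow> ('a \<times> 'a) set" where
  "adj_rel G = {(u, v). {u, v} \<in> edges G}"

definition connected_graph :: "'a ugraph \<Rightarrow> bool" where
  "connected_graph G \<longleftrightarrow>
     verts G \<noteq> {} \<and> (\<forall>u\<in>verts G. \<forall>v\<in>verts G. (u, v) \<in> (adj_rel G)\<^sup>*)"

definition degree :: "'a ugraph \<Rightarrow> 'a \<Rightarrow> nat" where
  "degree G v = card {e \<in> edges G. v \<in> e}"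

definition regular_graph :: "'a ugraph \<Rightarrow> bool" where
  "regular_graph G \<longleftrightarrow> (\<exists>r. \<forall>v\<in>verts G. degree G v = r)"

definition delete_edges :: "'a ugraph \<Rightarrow> 'a set set \<Rightarrow> 'a ugraph" where
  "delete_edges G F = \<lparr>verts = verts G, edges = edges G - F\<rparr>"

definition proper_edge_coloring :: "'a ugraph \<Rightarrow> nat \<Rightarrow> ('a set \<Rightarrow> nat) \<Rightarrow> bool" where
  "proper_edge_coloring G k c \<longleftrightarrow>
     (\<forall>e\<in>edges G. c e < k) \<and>
     (\<forall>e\<in>edges G. \<forall>f\<in>edges G. e \<noteq> f \<longrightarrow> e \<inter> f \<noteq> {} \<longrightarrow> c e \<noteq> c f)"

definition chromatic_index :: "'a ugraph \<Rightarrow> nat" where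
  "chromatic_index G = (LEAST k. \<exists>c. proper_edge_coloring G k c)"

text \<open>
  For a finite graph with at least one edge the minimum below is taken over a nonempty set,
  since deleting all edges brings the chromatic index down to \<open>0\<close>. For an edgeless graph the
  value is unspecified.
\<close>

definition chromatic_edge_stability_index :: "'a ugraph \<Rightarrow> nat" where
  "chromatic_edge_stability_index G =
     (LEAST m. \<exists>F. F \<subseteq> edges G \<and> card F = m \<and>
        chromatic_index (delete_edges G F) < chromatic_index G)"

definition graph_isomorphic :: "'a ugraph \<Rightarrow> 'b ugraph \<Rightarrow> bool" where
  "graph_isomorphic G H \<longleftrightarrow>
     (\<exists>f. bij_betw f (verts G) (verts H) \<and>
          (\<forall>u\<in>verts G. \<forall>v\<in>verts G. {u, v} \<in> edges G \<longleftrightarrow> {f u, f v} \<in> edges H))"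

definition complete_graph :: "nat \<Rightarrow> nat ugraph" where
  "complete_graph n =
     \<lparr>verts = {..<n}, edges = {{i, j} |i j. i < n \<and> j < n \<and> i \<noteq> j}\<rparr>"

text \<open>This is the cycle of order \<open>n\<close> only for \<open>n \<ge> 3\<close>.\<close>

definition cycle_graph :: "nat \<Rightarrow> nat ugraph" where
  "cycle_graph n = \<lparr>verts = {..<n}, edges = {{i, (i + 1) mod n} |i. i < n}\<rparr>"

lemma simple_graph_complete_graph: "simple_graph (complete_graph n)"
  by (auto simp: simple_graph_def complete_graph_def card_insert_if)

lemma simple_graph_cycle_graph:
  assumes "n \<ge> 3"
  shows "simple_graph (cycle_graph n)"
proof -
  have "(i + 1) mod n < n" "(i + 1) mod n \<noteq> i" if "i < n" for i
    using that assms by (cases "i + 1 = n"; simp)+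
  then show ?thesis
    by (fastforce simp: simple_graph_def cycle_graph_def card_insert_if)
qed

lemma chromatic_index_edgeless: "edges G = {} \<Longrightarrow> chromatic_index G = 0"
  by (simp add: chromatic_index_def proper_edge_coloring_def)

lemma chromatic_index_pos:
  assumes "simple_graph G" and "edges G \<noteq> {}"
  shows "chromatic_index G > 0"
proof -
  have "finite (edges G)"
    using assms(1) by (auto simp: simple_graph_def intro: finite_subset[of _ "Pow (verts G)"])
  then obtain c :: "'a set \<Rightarrow> nat" and k where "inj_on c (edges G)" "c ` edges G = {i. i < k}"
    using finite_imp_inj_to_nat_seg by blast
  then have "proper_edge_coloring G k c"
    by (auto simp: proper_edge_coloring_def inj_on_def)
  then have "\<exists>c. proper_edge_coloring G (chromatic_index G) c"
    unfolding chromatic_index_def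
    using LeastI[of "\<lambda>k. \<exists>c. proper_edge_coloring G k c" k] by auto
  then show ?thesis
    using assms(2) by (auto simp: proper_edge_coloring_def)
qed

end

theory Submission
  imports Defs
begin

text \<open>
  The stability index is \<open>1\<close> exactly when there are an edge \<open>e\<close> and a number \<open>k\<close> such that
  \<open>G - e\<close> has a proper edge coloring with \<open>k\<close> colors and \<open>G\<close> has none
  (\<open>chromatic_edge_stability_index_eq_1_iff\<close>). Let \<open>G\<close> be \<open>r\<close>-regular.

  Suppose that such \<open>e = uv\<close> and \<open>k\<close> exist. Vizing's argument shows that a \<open>k\<close>-coloring of all edges
  but one can be turned into a \<open>k\<close>-coloring of all edges whenever every degree is below \<open>k\<close>
  (\<open>vizing_extension\<close>). Hence \<open>k \<le> r\<close>, and \<open>G - e\<close> is \<open>r\<close>-colorable.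

  If \<open>G\<close> itself is \<open>r\<close>-colorable, then \<open>k < r\<close>, so \<open>G - e\<close> has no vertex of degree \<open>r\<close>. Every
  vertex is then an end of \<open>e\<close>, and \<open>G\<close> is \<open>K\<^sub>2\<close>.

  If \<open>G\<close> is not \<open>r\<close>-colorable, fix an \<open>r\<close>-coloring of \<open>G - e\<close>. All colors occur at each vertex
  other than \<open>u\<close> and \<open>v\<close>, and exactly one color is missing at \<open>u\<close> and one at \<open>v\<close>; these two
  colors differ, since otherwise \<open>e\<close> could receive the common one. Each color is seen by an even
  number of vertices, because its edges form a matching. The color missing at \<open>u\<close> is seen by all
  vertices but one, so the order of \<open>G\<close> is odd; a color missing at neither end would be seen
  by all vertices, so there is none. Hence \<open>r = 2\<close> (\<open>regular_critical_edge\<close>), and a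
  connected \<open>2\<close>-regular graph is a cycle (\<open>two_regular_connected_is_cycle\<close>).

  Conversely, deleting the only edge of \<open>K\<^sub>2\<close> leaves an edgeless graph, and deleting an edge of an
  odd cycle leaves a path, which is \<open>2\<close>-colorable while the odd cycle is not.
\<close>

section \<open>Edge colorings and missing colors\<close>

text \<open>
  Properness depends on the edges alone. Coloring bare edge sets lets the uncolored edge vary during
  the recoloring arguments below.
\<close>

definition edge_coloring :: "'a set set \<Rightarrow> nat \<Rightarrow> ('a set \<Rightarrow> nat) \<Rightarrow> bool" where
  "edge_coloring E k c \<longleftrightarrow> (\<forall>e\<in>E. c e < k) \<and>
     (\<forall>e\<in>E. \<forall>f\<in>E. e \<noteq> f \<longrightarrow> e \<inter> f \<noteq> {} \<longrightarrow> c e \<noteq> c f)"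

definition missing :: "'a set set \<Rightarrow> ('a set \<Rightarrow> nat) \<Rightarrow> 'a \<Rightarrow> nat \<Rightarrow> bool" where
  "missing E c v a \<longleftrightarrow> (\<forall>e\<in>E. v \<in> e \<longrightarrow> c e \<noteq> a)"

lemma proper_edge_coloring_iff: "proper_edge_coloring G k c \<longleftrightarrow> edge_coloring (edges G) k c"
  by (simp add: proper_edge_coloring_def edge_coloring_def)

lemma edge_coloring_less: "edge_coloring E k c \<Longrightarrow> e \<in> E \<Longrightarrow> c e < k"
  by (simp add: edge_coloring_def)

lemma edge_coloring_eqD:
  "edge_coloring E k c \<Longrightarrow> e \<in> E \<Longrightarrow> f \<in> E \<Longrightarrow> v \<in> e \<Longrightarrow> v \<in> f \<Longrightarrow> c e = c f \<Longrightarrow> e = f"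
  unfolding edge_coloring_def by blast

lemma inj_on_edges_at: "edge_coloring E k c \<Longrightarrow> inj_on c {e \<in> E. v \<in> e}"
  by (rule inj_onI) (blast dest: edge_coloring_eqD)

lemma edge_coloring_mono: "edge_coloring E k c \<Longrightarrow> k \<le> l \<Longrightarrow> edge_coloring E l c"
  by (auto simp: edge_coloring_def intro: less_le_trans)

lemma edge_coloring_subset: "edge_coloring F k c \<Longrightarrow> E \<subseteq> F \<Longrightarrow> edge_coloring E k c"
  unfolding edge_coloring_def by blast

lemma card_missing_colors:
  assumes "finite E" "edge_coloring E k c"
  shows "card {i. i < k \<and> missing E c v i} + card {e \<in> E. v \<in> e} = k"
proof -
  let ?A = "{e \<in> E. v \<in> e}"
  have "{i. i < k \<and> missing E c v i} \<union> c ` ?A = {..<k}"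
    using edge_coloring_less[OF assms(2)] by (auto simp: missing_def)
  moreover have "{i. i < k \<and> missing E c v i} \<inter> c ` ?A = {}"
    by (auto simp: missing_def)
  moreover have "card (c ` ?A) = card ?A"
    using inj_on_edges_at[OF assms(2)] by (rule card_image)
  ultimately show ?thesis
    using card_Un_disjoint[of "{i. i < k \<and> missing E c v i}" "c ` ?A"] assms(1) by simp
qed

lemma exists_missing_color:
  assumes "finite E" "edge_coloring E k c" "card {e \<in> E. v \<in> e} < k"
  shows "\<exists>a<k. missing E c v a"
proof -
  have "card {i. i < k \<and> missing E c v i} \<noteq> 0"
    using card_missing_colors[OF assms(1,2), of v] assms(3) by linarith
  then have "{i. i < k \<and> missing E c v i} \<noteq> {}"
    by (metis card.empty)
  then show ?thesis by blast
qed

lemma color_missing_edge: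
  assumes "edge_coloring (E - {{x, y}}) k c" "a < k"
    and "missing (E - {{x, y}}) c x a" "missing (E - {{x, y}}) c y a"
  shows "edge_coloring E k (c({x, y} := a))"
  unfolding edge_coloring_def
proof (intro conjI ballI impI)
  let ?c = "c({x, y} := a)"
  fix e assume "e \<in> E"
  then show "?c e < k" using assms(1,2) by (auto simp: edge_coloring_def)
next
  let ?c = "c({x, y} := a)"
  have *: "c e \<noteq> a" if "e \<in> E" "e \<noteq> {x, y}" "e \<inter> {x, y} \<noteq> {}" for e
    using assms(3,4) that unfolding missing_def by blast
  fix e f assume ef: "e \<in> E" "f \<in> E" "e \<noteq> f" "e \<inter> f \<noteq> {}"
  consider "e = {x, y}" | "f = {x, y}" | "e \<noteq> {x, y}" "f \<noteq> {x, y}" by blast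
  then show "?c e \<noteq> ?c f"
  proof cases
    case 1
    then have "c f \<noteq> a" using *[of f] ef by blast
    then show ?thesis using 1 ef(3) by auto
  next
    case 2
    then have "c e \<noteq> a" using *[of e] ef by blast
    then show ?thesis using 2 ef(3) by auto
  next
    case 3
    then show ?thesis using assms(1) ef by (simp add: edge_coloring_def)
  qed
qed

section \<open>Fans\<close>

text \<open>
  Vizing's fan at the center \<open>x\<close>: the edge from \<open>x\<close> to the first vertex is the uncolored one, and
  the color of each later edge of the fan is missing at the preceding vertex, so that the colors can
  be passed backwards.
\<close>

definition fan :: "'a set set \<Rightarrow> ('a set \<Rightarrow> nat) \<Rightarrow> 'a \<Rightarrow> 'a list \<Rightarrow> bool" where
  "fan E c x ys \<longleftrightarrow> ys \<noteq> [] \<and> distinct ys \<and> (\<forall>y\<in>set ys. {x, y} \<in> E) \<and>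
     (\<forall>i. Suc i < length ys \<longrightarrow> missing (E - {{x, hd ys}}) c (ys ! i) (c {x, ys ! Suc i}))"

text \<open>
  Giving \<open>xy\<close> the color of the next fan edge \<open>xz\<close> and uncoloring \<open>xz\<close> shortens the fan by one
  vertex. It keeps the coloring proper, since that color is missing at \<open>y\<close>, and it does not change
  which colors occur at \<open>x\<close> or at the later vertices. Once only the last vertex is left, its edge
  takes the color \<open>a\<close>, which is free at both ends.
\<close>

lemma rotate_fan:
  assumes "edge_coloring (E - {{x, hd ys}}) k c" "fan E c x ys" "\<forall>e\<in>E. card e = 2" "a < k"
    and "missing (E - {{x, hd ys}}) c x a" "missing (E - {{x, hd ys}}) c (last ys) a"
  shows "\<exists>c'. edge_coloring E k c'"
  using assms
proof (induction ys arbitrary: c)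
  case Nil
  then show ?case by (simp add: fan_def)
next
  case (Cons y ys)
  show ?case
  proof (cases ys)
    case Nil
    then show ?thesis
      using Cons.prems color_missing_edge[of E x y k c a] by auto
  next
    case (Cons z zs)
    let ?E = "E - {{x, y}}" and ?E' = "E - {{x, z}}"
    define c' where "c' = c({x, y} := c {x, z})"
    note prems = Cons.prems[simplified]
    have yz: "{x, y} \<in> E" "{x, z} \<in> E" "y \<noteq> z" "y \<notin> set ys" "distinct ys"
      and inE: "\<And>v. v \<in> set ys \<Longrightarrow> {x, v} \<in> E"
      using prems(2) Cons by (auto simp: fan_def)
    have ne: "v \<noteq> x" if "v \<in> set ys" for v
      using inE[OF that] prems(3) by force
    have yx: "y \<noteq> x" using yz(1) prems(3) by force
    have xyz: "{x, y} \<noteq> {x, z}"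
      using yz(3) yx ne[of z] by (auto simp: doubleton_eq_iff)
    have miss_y: "missing ?E c y (c {x, z})"
      using prems(2) Cons by (force simp: fan_def dest: spec[of _ 0])
    have transfer: "missing ?E' c' v d" if "missing ?E c v d" "v \<noteq> x" "v \<noteq> y" for v d
      using that by (auto simp: missing_def c'_def)
    have "edge_coloring ?E' k c'"
      unfolding edge_coloring_def
    proof (intro conjI ballI impI)
      fix e assume "e \<in> ?E'"
      then show "c' e < k"
        using edge_coloring_less[OF prems(1)] yz xyz by (auto simp: c'_def)
    next
      have *: "c e \<noteq> c {x, z}" if e: "e \<in> ?E'" "e \<noteq> {x, y}" "e \<inter> {x, y} \<noteq> {}" for e
      proof (cases "x \<in> e")
        case True
        then show ?thesis
          using edge_coloring_eqD[OF prems(1), of e "{x, z}" x] e yz xyz by auto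
      next
        case False
        then show ?thesis using e miss_y by (auto simp: missing_def)
      qed
      fix e f assume ef: "e \<in> ?E'" "f \<in> ?E'" "e \<noteq> f" "e \<inter> f \<noteq> {}"
      show "c' e \<noteq> c' f"
      proof -
        consider "e = {x, y}" | "f = {x, y}" | "e \<noteq> {x, y}" "f \<noteq> {x, y}" by blast
        then show ?thesis
        proof cases
          case 1
          then have "c f \<noteq> c {x, z}" using *[of f] ef by blast
          then show ?thesis using 1 ef(3) by (auto simp: c'_def)
        next
          case 2
          then have "c e \<noteq> c {x, z}" using *[of e] ef by blast
          then show ?thesis using 2 ef(3) by (auto simp: c'_def)
        next
          case 3
          then show ?thesis using prems(1) ef by (simp add: c'_def edge_coloring_def)
        qed
      qed
    qed
    moreover have "fan E c' x ys"
      unfolding fan_def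
    proof (intro conjI allI impI ballI)
      fix i assume i: "Suc i < length ys"
      have "missing ?E c (ys ! i) (c {x, ys ! Suc i})"
        using prems(2) i unfolding fan_def by (auto dest: spec[of _ "Suc i"])
      moreover have "ys ! i \<noteq> x" "ys ! i \<noteq> y" "ys ! Suc i \<noteq> x" "ys ! Suc i \<noteq> y"
        using i ne yz(4) nth_mem[of i ys] nth_mem[of "Suc i" ys] by auto
      moreover from this have "{x, ys ! Suc i} \<noteq> {x, y}"
        by (auto simp: doubleton_eq_iff)
      ultimately show "missing (E - {{x, hd ys}}) c' (ys ! i) (c' {x, ys ! Suc i})"
        using transfer Cons by (simp add: c'_def)
    qed (use yz inE Cons in auto)
    moreover have "missing ?E' c' x a"
      using prems(5) yz xyz by (auto simp: missing_def c'_def)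
    moreover have "missing ?E' c' (last ys) a"
    proof -
      have "last ys \<in> set ys" using Cons by auto
      then have "last ys \<noteq> x" "last ys \<noteq> y" using ne yz(4) by blast+
      then show ?thesis using transfer prems(6) Cons by simp
    qed
    ultimately show ?thesis
      using Cons.IH[of c'] prems(3,4) Cons by simp
  qed
qed

section \<open>Kempe chains\<close>

text \<open>
  \<open>S\<close> is a union of components of the subgraph formed by the edges of color \<open>a\<close> or \<open>b\<close>. Only
  this closure under components matters for exchanging colors.
\<close>

definition kempe_closed ::
  "'a set set \<Rightarrow> ('a set \<Rightarrow> nat) \<Rightarrow> nat \<Rightarrow> nat \<Rightarrow> 'a set \<Rightarrow> bool" where
  "kempe_closed E c a b S \<longleftrightarrow> (\<forall>e\<in>E. c e \<in> {a, b} \<longrightarrow> e \<subseteq> S \<or> e \<inter> S = {})"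

text \<open>
  The exchange is made outside \<open>S\<close>. In the application \<open>S\<close> contains the center of a fan, and the
  colors of all edges at the center then stay as they are.
\<close>

definition kempe_swap :: "nat \<Rightarrow> nat \<Rightarrow> 'a set \<Rightarrow> ('a set \<Rightarrow> nat) \<Rightarrow> 'a set \<Rightarrow> nat" where
  "kempe_swap a b S c e =
     (if e \<inter> S \<noteq> {} then c e else if c e = a then b else if c e = b then a else c e)"

lemma edge_coloring_kempe_swap:
  assumes "edge_coloring E k c" "kempe_closed E c a b S" "a < k" "b < k"
  shows "edge_coloring E k (kempe_swap a b S c)"
  unfolding edge_coloring_def
proof (intro conjI ballI impI)
  fix e assume "e \<in> E"
  then show "kempe_swap a b S c e < k"
    using assms by (auto simp: kempe_swap_def edge_coloring_def)
next
  fix e f assume ef: "e \<in> E" "f \<in> E" "e \<noteq> f" "e \<inter> f \<noteq> {}"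
  then have ne: "c e \<noteq> c f" using assms(1) by (auto simp: edge_coloring_def)
  have *: "c e \<notin> {a, b}" if "e \<in> E" "e \<inter> S \<noteq> {}" "f \<inter> S = {}" "e \<inter> f \<noteq> {}" for e f
    using assms(2) that unfolding kempe_closed_def by blast
  show "kempe_swap a b S c e \<noteq> kempe_swap a b S c f"
    using *[of e f] *[of f e] ef ne by (auto simp: kempe_swap_def Int_commute)
qed

lemma missing_kempe_swap_inside:
  "v \<in> S \<Longrightarrow> missing E (kempe_swap a b S c) v d \<longleftrightarrow> missing E c v d"
  unfolding missing_def kempe_swap_def by auto

lemma missing_kempe_swap_other:
  "d \<noteq> a \<Longrightarrow> d \<noteq> b \<Longrightarrow> missing E (kempe_swap a b S c) v d \<longleftrightarrow> missing E c v d"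
  unfolding missing_def kempe_swap_def by auto

lemma missing_kempe_swap_outside:
  assumes "kempe_closed E c a b S" "v \<notin> S" "missing E c v b"
  shows "missing E (kempe_swap a b S c) v a"
  using assms unfolding missing_def kempe_swap_def kempe_closed_def by auto

text \<open>
  The subgraph of the edges of color \<open>a\<close> or \<open>b\<close> has maximum degree \<open>2\<close>, and \<open>x\<close> has degree at
  most \<open>1\<close> in it. Its component containing \<open>x\<close> is therefore a path, and only the other end \<open>w\<close> of
  the path can also lack one of the two colors.
\<close>

lemma kempe_chain:
  assumes "finite V" "\<forall>e\<in>E. e \<subseteq> V \<and> card e = 2" "edge_coloring E k c"
    and "missing E c x a" "x \<in> V"
  shows "\<exists>S w. x \<in> S \<and> kempe_closed E c a b S \<and>
    (\<forall>v\<in>S. missing E c v a \<or> missing E c v b \<longrightarrow> v = x \<or> v = w)"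
proof -
  \<comment> \<open>\<open>T\<close> is the part of the path traversed so far, \<open>w\<close> its current end, and \<open>d\<close> the only color with
    which the path can continue.\<close>
  have grow: "\<exists>S w. x \<in> S \<and> kempe_closed E c a b S \<and>
      (\<forall>v\<in>S. missing E c v a \<or> missing E c v b \<longrightarrow> v = x \<or> v = w)"
    if "x \<in> T" "w \<in> T" "T \<subseteq> V" "{d, d'} = {a, b}"
      and "\<forall>v\<in>T. missing E c v a \<or> missing E c v b \<longrightarrow> v = x \<or> v = w"
      and "w = x \<or> \<not> missing E c w d'"
      and "\<forall>e\<in>E. c e \<in> {a, b} \<longrightarrow> \<not> e \<subseteq> T \<longrightarrow> e \<inter> T \<noteq> {} \<longrightarrow> w \<in> e \<and> c e = d"
    for T w d d'
    using that
  proof (induction "card (V - T)" arbitrary: T w d d' rule: less_induct)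
    case less
    show ?case
    proof (cases "kempe_closed E c a b T")
      case True
      then show ?thesis using less.prems by blast
    next
      case False
      then obtain e where e: "e \<in> E" "c e \<in> {a, b}" "\<not> e \<subseteq> T" "e \<inter> T \<noteq> {}"
        unfolding kempe_closed_def by blast
      then have we: "w \<in> e" "c e = d" using less.prems(7) by blast+
      obtain w' where w': "e = {w, w'}" "w' \<noteq> w"
        using assms(2) e(1) we(1) by (metis card_2_iff doubleton_eq_iff insertE singletonD)
      have w'T: "w' \<notin> T" using e(3) w' less.prems(2) by auto
      have w'V: "w' \<in> V" using e(1) w' assms(2) by auto
      let ?T = "insert w' T"
      have "card (V - ?T) < card (V - T)"
        by (rule psubset_card_mono) (use assms(1) w'T w'V in auto)
      moreover have "\<forall>v\<in>?T. missing E c v a \<or> missing E c v b \<longrightarrow> v = x \<or> v = w'"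
      proof -
        have "\<not> missing E c w d" using e(1) we by (auto simp: missing_def)
        then have "w = x \<or> \<not> missing E c w a \<and> \<not> missing E c w b"
          using less.prems(4,6) by (auto simp: doubleton_eq_iff)
        then show ?thesis using less.prems(5) by blast
      qed
      moreover have "\<not> missing E c w' d" using e(1) we w' by (auto simp: missing_def)
      moreover have "\<forall>f\<in>E. c f \<in> {a, b} \<longrightarrow> \<not> f \<subseteq> ?T \<longrightarrow> f \<inter> ?T \<noteq> {} \<longrightarrow> w' \<in> f \<and> c f = d'"
      proof (intro ballI impI)
        fix f assume f: "f \<in> E" "c f \<in> {a, b}" "\<not> f \<subseteq> ?T" "f \<inter> ?T \<noteq> {}"
        have fe: "f \<noteq> e" using f(3) w' less.prems(2) by auto
        have "f \<inter> T = {}"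
        proof (rule ccontr)
          assume "f \<inter> T \<noteq> {}"
          then have "w \<in> f" "c f = d" using less.prems(7) f by blast+
          then show False using edge_coloring_eqD[OF assms(3) f(1) e(1)] we fe by auto
        qed
        then have "w' \<in> f" using f(4) by auto
        moreover from this have "c f \<noteq> d"
          using edge_coloring_eqD[OF assms(3) f(1) e(1)] we fe w' by auto
        ultimately show "w' \<in> f \<and> c f = d'" using f(2) less.prems(4) by (auto simp: doubleton_eq_iff)
      qed
      ultimately show ?thesis
        using less.hyps[of ?T w' d' d] less.prems(1,3,4) w'V by (auto simp: insert_commute)
    qed
  qed
  show ?thesis
    by (rule grow[of "{x}" x b a]) (use assms in \<open>auto simp: missing_def\<close>)
qed

section \<open>Vizing's extension argument\<close>

text \<open>
  Let \<open>a\<close> be missing at \<open>x\<close>, take a longest fan, and let \<open>b\<close> be missing at its last vertex \<open>y\<^sub>n\<close>. If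
  \<open>b\<close> is missing at \<open>x\<close> too, rotating the fan finishes. Otherwise the \<open>b\<close>-edge at \<open>x\<close> leads to
  some fan vertex \<open>y\<^sub>j\<close> by maximality, so \<open>b\<close> is also missing at \<open>y\<^sub>i\<close> with \<open>i = j - 1\<close>. By
  \<open>kempe_chain\<close>, at most one of \<open>y\<^sub>i\<close> and \<open>y\<^sub>n\<close> lies in the \<open>a\<close>-\<open>b\<close> component of \<open>x\<close>. Exchanging
  \<open>a\<close> and \<open>b\<close> outside this component makes \<open>a\<close> missing at \<open>x\<close> and at one of the two vertices,
  and the fan up to that vertex can be rotated.
\<close>

lemma vizing_extension:
  assumes "finite V" "\<forall>e\<in>E. e \<subseteq> V \<and> card e = 2"
    and deg: "\<And>v. v \<in> V \<Longrightarrow> card {e \<in> E. v \<in> e} < k"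
    and "e0 \<in> E" "edge_coloring (E - {e0}) k c"
  shows "\<exists>c'. edge_coloring E k c'"
proof -
  obtain x y0 where e0: "e0 = {x, y0}" using assms(2,4) by (metis card_2_iff)
  let ?E = "E - {{x, y0}}"
  have finE: "finite E" using assms(1,2) by (auto intro: finite_subset[of _ "Pow V"])
  have card2: "\<forall>e\<in>E. card e = 2" using assms(2) by auto
  have col: "edge_coloring ?E k c" using assms(5) e0 by simp
  have exmiss: "\<exists>d<k. missing ?E c v d" if "v \<in> V" for v
  proof (rule exists_missing_color)
    have "card {e \<in> ?E. v \<in> e} \<le> card {e \<in> E. v \<in> e}"
      by (rule card_mono) (use finE in auto)
    then show "card {e \<in> ?E. v \<in> e} < k" using deg[OF that] by simp
  qed (use finE col in auto)
  have xV: "x \<in> V" "y0 \<in> V" using assms(2,4) e0 by auto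
  obtain a where a: "a < k" "missing ?E c x a" using exmiss xV by blast
  define P where "P ys \<longleftrightarrow> fan E c x ys \<and> hd ys = y0" for ys
  have PV: "set ys \<subseteq> V" "x \<notin> set ys" if "P ys" for ys
    using that assms(2) by (force simp: P_def fan_def)+
  have "P [y0]" using assms(4) e0 by (auto simp: P_def fan_def)
  moreover have "length ys < Suc (card V)" if "P ys" for ys
    using PV[OF that] that assms(1) card_mono[of V "set ys"]
    by (auto simp: P_def fan_def distinct_card less_Suc_eq_le)
  ultimately obtain ys where ys: "P ys" and maxi: "\<And>zs. P zs \<Longrightarrow> length zs \<le> length ys"
    using ex_has_greatest_nat[of P "[y0]" length "Suc (card V)"] by blast
  have fan: "fan E c x ys" and hd: "hd ys = y0" and nonempty: "ys \<noteq> []"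
    and dist: "distinct ys" using ys by (auto simp: P_def fan_def)
  define n where "n = length ys - 1"
  have n: "length ys = Suc n" using nonempty by (simp add: n_def)
  have last: "last ys = ys ! n" using nonempty by (simp add: last_conv_nth n_def)
  have fan_step: "missing ?E c (ys ! i) (c {x, ys ! Suc i})" if "Suc i < length ys" for i
    using fan that hd by (auto simp: fan_def)
  have inE: "{x, ys ! i} \<in> E" if "i < length ys" for i
    using fan that by (auto simp: fan_def)
  have lastV: "last ys \<in> V" using PV(1)[OF ys] nonempty by auto
  obtain b where b: "b < k" "missing ?E c (last ys) b" using exmiss[OF lastV] by blast
  show ?thesis
  proof (cases "missing ?E c x b")
    case True
    then show ?thesis
      using rotate_fan[OF _ fan card2 b(1)] b col hd by simp
  next
    case False
    then obtain f where f: "f \<in> ?E" "x \<in> f" "c f = b" by (auto simp: missing_def)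
    obtain z where z: "f = {x, z}"
      using card2 f(1,2) by (metis Diff_iff card_2_iff doubleton_eq_iff insertE singletonD)
    have zy0: "z \<noteq> y0" using f(1) z by auto
    have "z \<in> set ys"
    proof (rule ccontr)
      assume z': "z \<notin> set ys"
      have "fan E c x (ys @ [z])"
        unfolding fan_def
      proof (intro conjI allI impI)
        fix i assume i: "Suc i < length (ys @ [z])"
        show "missing (E - {{x, hd (ys @ [z])}}) c ((ys @ [z]) ! i) (c {x, (ys @ [z]) ! Suc i})"
        proof (cases "Suc i < length ys")
          case True
          then show ?thesis using fan_step[OF True] hd nonempty by (simp add: nth_append)
        next
          case False
          then have "i = n" using i n by simp
          then show ?thesis using b(2) last n hd f z nonempty by (simp add: nth_append)
        qed
      qed (use fan z' f z in \<open>auto simp: fan_def\<close>)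
      then have "P (ys @ [z])" using hd nonempty by (simp add: P_def)
      then show False using maxi[of "ys @ [z]"] by simp
    qed
    then obtain j where j: "j < length ys" "ys ! j = z" by (auto simp: in_set_conv_nth)
    have "ys ! 0 = y0" using hd nonempty by (simp add: hd_conv_nth)
    then have "j \<noteq> 0" using zy0 j(2) by metis
    then obtain i where i: "j = Suc i" by (cases j) auto
    have "j \<noteq> n" using b(2) last j f z by (auto simp: missing_def)
    then have jn: "j < n" using j n by simp
    have miss_i: "missing ?E c (ys ! i) b" using fan_step[of i] i j f z by simp
    have color_ne_a: "c {x, ys ! l} \<noteq> a" if "l < length ys" "l \<noteq> 0" for l
    proof -
      have "ys ! l \<noteq> ys ! 0" using that dist nonempty nth_eq_iff_index_eq[of ys l 0] by simp
      then have "{x, ys ! l} \<noteq> {x, y0}" using hd nonempty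
        by (auto simp: doubleton_eq_iff hd_conv_nth)
      then show ?thesis using a(2) inE[OF that(1)] by (auto simp: missing_def)
    qed
    have color_ne_b: "c {x, ys ! l} \<noteq> b" if "l < length ys" "l \<noteq> 0" "l \<noteq> j" for l
    proof
      assume cb: "c {x, ys ! l} = b"
      have "ys ! l \<noteq> ys ! 0" "ys ! l \<noteq> z"
        using that dist nonempty j nth_eq_iff_index_eq[of ys l 0] nth_eq_iff_index_eq[of ys l j] by auto
      then have "{x, ys ! l} \<noteq> {x, y0}" "{x, ys ! l} \<noteq> {x, z}" using hd nonempty
        by (auto simp: doubleton_eq_iff hd_conv_nth)
      then show False
        using edge_coloring_eqD[OF col, of "{x, ys ! l}" f x] inE[OF that(1)] f z cb by auto
    qed
    obtain S w where S: "x \<in> S" "kempe_closed ?E c a b S"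
      and ends: "\<forall>v\<in>S. missing ?E c v a \<or> missing ?E c v b \<longrightarrow> v = x \<or> v = w"
      using kempe_chain[OF assms(1) _ col a(2) xV(1), of b] assms(2) by auto
    let ?c = "kempe_swap a b S c"
    have col': "edge_coloring ?E k ?c"
      using edge_coloring_kempe_swap[OF col S(2) a(1) b(1)] .
    have x_a: "missing ?E ?c x a" using a(2) S(1) by (simp add: missing_kempe_swap_inside)
    have same: "?c {x, v} = c {x, v}" for v using S(1) by (simp add: kempe_swap_def)
    \<comment> \<open>The initial part of the fan ending in \<open>y\<^sub>m\<close> survives the exchange: \<open>a\<close> does not occur in the fan,
      and \<open>b\<close> occurs only on the edge to \<open>y\<^sub>j\<close>. If that edge is included, \<open>b\<close> has to stay missing
      at \<open>y\<^sub>i\<close>, which holds inside \<open>S\<close>.\<close>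
    have finish: ?thesis if m: "m < length ys" "ys ! m \<notin> S" "missing ?E c (ys ! m) b"
      and keep: "j \<le> m \<longrightarrow> ys ! i \<in> S" for m
    proof (rule rotate_fan[of E x "take (Suc m) ys" k ?c a])
      let ?ys = "take (Suc m) ys"
      have hd': "hd ?ys = y0" using hd nonempty by (cases ys) auto
      show "edge_coloring (E - {{x, hd ?ys}}) k ?c" using col' hd' by simp
      show "fan E ?c x ?ys"
        unfolding fan_def hd'
      proof (intro conjI allI impI)
        fix l assume l: "Suc l < length ?ys"
        have "missing ?E ?c (ys ! l) (c {x, ys ! Suc l})"
        proof (cases "l = i")
          case True
          then have "ys ! l \<in> S" using keep l i by auto
          then show ?thesis using True fan_step[of l] l by (simp add: missing_kempe_swap_inside)
        next
          case False
          then show ?thesis using fan_step[of l] l color_ne_a[of "Suc l"] color_ne_b[of "Suc l"] i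
            by (simp add: missing_kempe_swap_other)
        qed
        then show "missing ?E ?c (?ys ! l) (?c {x, ?ys ! Suc l})" using l by (simp add: same)
      qed (use fan in \<open>auto simp: fan_def dest: in_set_takeD\<close>)
      have "last ?ys = ys ! m" using m(1) by (simp add: take_Suc_conv_app_nth)
      then show "missing (E - {{x, hd ?ys}}) ?c (last ?ys) a"
        using missing_kempe_swap_outside[OF S(2) m(2,3)] hd' by simp
      show "missing (E - {{x, hd ?ys}}) ?c x a" using x_a hd' by simp
    qed (use card2 a in auto)
    have ine: "ys ! i \<noteq> ys ! n" using dist i jn n by (simp add: nth_eq_iff_index_eq)
    have "ys ! i \<noteq> x" "ys ! n \<noteq> x"
      using PV(2)[OF ys] nth_mem[of i ys] nth_mem[of n ys] i jn n by auto
    then have "ys ! i \<notin> S \<or> ys ! n \<notin> S"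
      using ends ine miss_i b(2) last by metis
    then show ?thesis
    proof (cases "ys ! i \<in> S")
      case True
      then show ?thesis using finish[of n] \<open>ys ! i \<notin> S \<or> ys ! n \<notin> S\<close> n b(2) last by auto
    next
      case False
      then show ?thesis using finish[of i] miss_i i j by auto
    qed
  qed
qed

section \<open>Stability index one\<close>

lemma finite_edges: "simple_graph G \<Longrightarrow> finite (edges G)"
  by (auto simp: simple_graph_def intro: finite_subset[of _ "Pow (verts G)"])

lemma chromatic_index_le: "edge_coloring (edges G) k c \<Longrightarrow> chromatic_index G \<le> k"
  unfolding chromatic_index_def by (rule Least_le) (auto simp: proper_edge_coloring_iff)

lemma chromatic_index_attained:
  assumes "finite (edges G)"
  shows "\<exists>c. edge_coloring (edges G) (chromatic_index G) c"
proof -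
  obtain c :: "'a set \<Rightarrow> nat" and k where "inj_on c (edges G)" "c ` edges G = {i. i < k}"
    using assms finite_imp_inj_to_nat_seg by blast
  then have "proper_edge_coloring G k c"
    by (auto simp: proper_edge_coloring_def inj_on_def)
  then show ?thesis
    unfolding chromatic_index_def proper_edge_coloring_iff[symmetric]
    using LeastI[of "\<lambda>k. \<exists>c. proper_edge_coloring G k c" k] by auto
qed

lemma chromatic_index_less_iff:
  assumes "finite (edges G)" "finite (edges H)"
  shows "chromatic_index H < chromatic_index G \<longleftrightarrow>
    (\<exists>k. (\<exists>c. edge_coloring (edges H) k c) \<and> \<not> (\<exists>c. edge_coloring (edges G) k c))"
proof
  assume "chromatic_index H < chromatic_index G"
  then show "\<exists>k. (\<exists>c. edge_coloring (edges H) k c) \<and> \<not> (\<exists>c. edge_coloring (edges G) k c)"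
    using chromatic_index_attained[OF assms(2)] chromatic_index_le[of G] leD by blast
next
  assume "\<exists>k. (\<exists>c. edge_coloring (edges H) k c) \<and> \<not> (\<exists>c. edge_coloring (edges G) k c)"
  then obtain k c where k: "edge_coloring (edges H) k c" "\<not> (\<exists>c. edge_coloring (edges G) k c)"
    by blast
  have "k < chromatic_index G"
  proof (rule ccontr)
    assume "\<not> k < chromatic_index G"
    then show False
      using chromatic_index_attained[OF assms(1)] edge_coloring_mono k(2) leI by blast
  qed
  then show "chromatic_index H < chromatic_index G"
    using chromatic_index_le[OF k(1)] by simp
qed

text \<open>
  Quantifying over \<open>k\<close> instead of comparing chromatic indices reduces the rest of the proof to the
  existence of colorings.
\<close>

lemma chromatic_edge_stability_index_eq_1_iff:
  assumes "simple_graph G" "edges G \<noteq> {}"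
  shows "chromatic_edge_stability_index G = 1 \<longleftrightarrow>
    (\<exists>e\<in>edges G. \<exists>k. (\<exists>c. edge_coloring (edges G - {e}) k c) \<and> \<not> (\<exists>c. edge_coloring (edges G) k c))"
proof -
  note fin = finite_edges[OF assms(1)]
  let ?Q = "\<lambda>m. \<exists>F. F \<subseteq> edges G \<and> card F = m \<and>
        chromatic_index (delete_edges G F) < chromatic_index G"
  have "chromatic_index (delete_edges G (edges G)) < chromatic_index G"
    using assms by (simp add: chromatic_index_edgeless chromatic_index_pos delete_edges_def)
  then have "?Q (card (edges G))" by blast
  then have attained: "?Q (chromatic_edge_stability_index G)"
    unfolding chromatic_edge_stability_index_def by (rule LeastI)
  have "F = {}" if "F \<subseteq> edges G" "card F = 0" for F
    using that finite_subset[OF that(1) fin] by simp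
  moreover have "delete_edges G {} = G"
    by (simp add: delete_edges_def)
  ultimately have "\<not> ?Q 0"
    by (metis less_irrefl)
  then have "chromatic_edge_stability_index G = 1 \<longleftrightarrow> ?Q 1"
    using attained Least_le[of ?Q 1] unfolding chromatic_edge_stability_index_def
    by (metis One_nat_def le_Suc_eq le_zero_eq)
  also have "\<dots> \<longleftrightarrow> (\<exists>e\<in>edges G. chromatic_index (delete_edges G {e}) < chromatic_index G)"
    by (auto simp: card_1_singleton_iff)
  also have "\<dots> \<longleftrightarrow> (\<exists>e\<in>edges G. \<exists>k. (\<exists>c. edge_coloring (edges G - {e}) k c) \<and>
      \<not> (\<exists>c. edge_coloring (edges G) k c))"
    using fin by (simp add: chromatic_index_less_iff delete_edges_def)
  finally show ?thesis .
qed

section \<open>Critical edges of regular graphs\<close>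

text \<open>
  The edges of one color form a matching, and the vertices at which the color occurs are those that
  the matching covers.
\<close>

lemma even_card_color_class:
  assumes "finite E" "\<forall>e\<in>E. card e = 2" "edge_coloring E k c"
  shows "even (card {v. \<not> missing E c v i})"
proof -
  let ?M = "{e \<in> E. c e = i}"
  have "{v. \<not> missing E c v i} = \<Union>?M" by (auto simp: missing_def)
  moreover have "card (\<Union>?M) = sum card ?M"
  proof (rule card_Union_disjoint)
    show "pairwise disjnt ?M"
      using edge_coloring_eqD[OF assms(3)] by (auto simp: pairwise_def disjnt_def)
    show "finite e" if "e \<in> ?M" for e
      using that assms(2) by (auto intro: card_ge_0_finite)
  qed
  moreover have "sum card ?M = 2 * card ?M"
    using assms(2) by simp
  ultimately show ?thesis by simp
qed

text \<open>
  This is the parity count: in an \<open>r\<close>-coloring of all edges but \<open>uv\<close>, the ends \<open>u\<close> and \<open>v\<close> each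
  lack one color \<open>\<alpha>\<close> or \<open>\<beta>\<close>, with \<open>\<alpha> \<noteq> \<beta>\<close>, and no other vertex lacks any. The color \<open>\<alpha>\<close> covers
  \<open>card V - 1\<close> vertices, and every color besides \<open>\<alpha>\<close> and \<open>\<beta>\<close> would cover \<open>card V\<close> of them, but both
  numbers cannot be even.
\<close>

lemma regular_critical_edge:
  assumes "finite V" "\<forall>e\<in>E. e \<subseteq> V \<and> card e = 2"
    and deg: "\<And>v. v \<in> V \<Longrightarrow> card {e \<in> E. v \<in> e} = r"
    and "e0 \<in> E" "edge_coloring (E - {e0}) r c" "\<not> (\<exists>c'. edge_coloring E r c')"
  shows "r = 2 \<and> odd (card V)"
proof -
  obtain u v where e0: "e0 = {u, v}" "u \<noteq> v" using assms(2,4) by (metis card_2_iff)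
  have uv: "u \<in> V" "v \<in> V" using assms(2,4) e0 by auto
  let ?E = "E - {e0}"
  let ?M = "\<lambda>w. {i. i < r \<and> missing ?E c w i}"
  have finE: "finite E" using assms(1,2) by (auto intro: finite_subset[of _ "Pow V"])
  have card2: "\<forall>e\<in>?E. card e = 2" using assms(2) by auto
  have count: "card (?M w) + card {e \<in> ?E. w \<in> e} = r" for w
    using card_missing_colors[OF _ assms(5)] finE by simp
  have ends: "card (?M w) = 1" if "w \<in> e0" for w
  proof -
    have "{e \<in> E. w \<in> e} = insert e0 {e \<in> ?E. w \<in> e}" using assms(4) that by auto
    then have "r = Suc (card {e \<in> ?E. w \<in> e})"
      using deg[of w] that uv e0(1) finE by auto
    then show ?thesis using count[of w] by simp
  qed
  obtain \<alpha> where \<alpha>: "?M u = {\<alpha>}" using ends[of u] e0(1) by (auto simp: card_1_singleton_iff)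
  obtain \<beta> where \<beta>: "?M v = {\<beta>}" using ends[of v] e0(1) by (auto simp: card_1_singleton_iff)
  have ab: "\<alpha> < r" "\<beta> < r" "missing ?E c u \<alpha>" "missing ?E c v \<beta>" using \<alpha> \<beta> by blast+
  have "\<alpha> \<noteq> \<beta>"
    using color_missing_edge[of E u v r c \<alpha>] ab assms(5,6) e0(1) by blast
  have others: "?M w = {}" if "w \<in> V" "w \<notin> e0" for w
  proof -
    have "{e \<in> ?E. w \<in> e} = {e \<in> E. w \<in> e}" using that by auto
    then show ?thesis using count[of w] deg[OF that(1)] by simp
  qed
  have inV: "w \<in> V" if "\<not> missing ?E c w i" for w i
    using that assms(2) by (auto simp: missing_def)
  have even: "even (card {w. \<not> missing ?E c w i})" for i
    by (rule even_card_color_class[OF _ card2 assms(5)]) (use finE in simp)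
  have "w = u" if "w \<in> V" "missing ?E c w \<alpha>" for w
    using others[of w] that ab \<beta> \<open>\<alpha> \<noteq> \<beta>\<close> e0 by blast
  then have "{w. \<not> missing ?E c w \<alpha>} = V - {u}"
    using inV ab by blast
  then have "even (card V - 1)"
    using even[of \<alpha>] uv(1) by simp
  moreover have "card V > 0" using uv(1) assms(1) by (auto simp: card_gt_0_iff)
  ultimately have "odd (card V)" by simp
  have "{..<r} \<subseteq> {\<alpha>, \<beta>}"
  proof
    fix i assume i: "i \<in> {..<r}"
    show "i \<in> {\<alpha>, \<beta>}"
    proof (rule ccontr)
      assume "i \<notin> {\<alpha>, \<beta>}"
      then have "\<not> missing ?E c w i" if "w \<in> V" for w
        using others[OF that] i \<alpha> \<beta> e0(1) by blast
      then have "{w. \<not> missing ?E c w i} = V" using inV by blast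
      then show False using even[of i] \<open>odd (card V)\<close> by simp
    qed
  qed
  then have "{..<r} = {\<alpha>, \<beta>}" using ab by blast
  then have "card {..<r} = 2" using \<open>\<alpha> \<noteq> \<beta>\<close> by simp
  then show ?thesis using \<open>odd (card V)\<close> by simp
qed

section \<open>Complete graphs of order two and cycles up to isomorphism\<close>

text \<open>
  Since edges have two distinct ends, a vertex bijection preserves adjacency of pairs exactly when it
  carries the edge set over. The map runs from \<open>H\<close> to \<open>G\<close> so that, for a concrete \<open>H\<close>, it
  enumerates the vertices of \<open>G\<close>.
\<close>

lemma graph_isomorphic_iff_edges_image:
  assumes "simple_graph G" "simple_graph H"
  shows "graph_isomorphic G H \<longleftrightarrow>
    (\<exists>g. bij_betw g (verts H) (verts G) \<and> edges G = (`) g ` edges H)"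
proof
  assume "graph_isomorphic G H"
  then obtain f where f: "bij_betw f (verts G) (verts H)"
    and adj: "\<And>u v. u \<in> verts G \<Longrightarrow> v \<in> verts G \<Longrightarrow> {u, v} \<in> edges G \<longleftrightarrow> {f u, f v} \<in> edges H"
    unfolding graph_isomorphic_def by blast
  let ?g = "inv_into (verts G) f"
  have g: "bij_betw ?g (verts H) (verts G)" using f by (rule bij_betw_inv_into)
  have "edges G = (`) ?g ` edges H"
  proof
    show "edges G \<subseteq> (`) ?g ` edges H"
    proof
      fix e assume e: "e \<in> edges G"
      then obtain u v where uv: "e = {u, v}" "u \<in> verts G" "v \<in> verts G"
        using assms(1) unfolding simple_graph_def by (metis card_2_iff insert_subset)
      then have "{f u, f v} \<in> edges H" using adj e by simp
      moreover have "?g ` {f u, f v} = e"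
        using uv f by (simp add: bij_betw_inv_into_left)
      ultimately show "e \<in> (`) ?g ` edges H" by blast
    qed
    show "(`) ?g ` edges H \<subseteq> edges G"
    proof clarify
      fix h assume h: "h \<in> edges H"
      then obtain a b where ab: "h = {a, b}" "a \<in> verts H" "b \<in> verts H"
        using assms(2) unfolding simple_graph_def by (metis card_2_iff insert_subset)
      then have "{?g a, ?g b} \<in> edges G"
        using adj[of "?g a" "?g b"] h f g
        by (simp add: bij_betw_inv_into_right bij_betwE)
      then show "?g ` h \<in> edges G" using ab by simp
    qed
  qed
  then show "\<exists>g. bij_betw g (verts H) (verts G) \<and> edges G = (`) g ` edges H"
    using g by blast
next
  assume "\<exists>g. bij_betw g (verts H) (verts G) \<and> edges G = (`) g ` edges H"
  then obtain g where g: "bij_betw g (verts H) (verts G)" and E: "edges G = (`) g ` edges H"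
    by blast
  let ?f = "inv_into (verts H) g"
  have f: "bij_betw ?f (verts G) (verts H)" using g by (rule bij_betw_inv_into)
  have "{u, v} \<in> edges G \<longleftrightarrow> {?f u, ?f v} \<in> edges H" if "u \<in> verts G" "v \<in> verts G" for u v
  proof
    assume "{u, v} \<in> edges G"
    then obtain h where h: "h \<in> edges H" "{u, v} = g ` h" using E by auto
    then have "h \<subseteq> verts H" using assms(2) by (simp add: simple_graph_def)
    then have "?f ` {u, v} = h"
      using h(2) g by (simp add: bij_betw_def inv_into_image_cancel)
    then show "{?f u, ?f v} \<in> edges H" using h(1) by simp
  next
    assume "{?f u, ?f v} \<in> edges H"
    then have "g ` {?f u, ?f v} \<in> edges G" using E by blast
    then show "{u, v} \<in> edges G" using that g by (simp add: bij_betw_inv_into_right)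
  qed
  then show "graph_isomorphic G H" using f unfolding graph_isomorphic_def by blast
qed

lemma graph_isomorphic_cycle_graph_iff:
  assumes "simple_graph G" "n \<ge> 3"
  shows "graph_isomorphic G (cycle_graph n) \<longleftrightarrow>
    (\<exists>g. bij_betw g {..<n} (verts G) \<and> edges G = (\<lambda>i. {g i, g ((i + 1) mod n)}) ` {..<n})"
proof -
  have "edges (cycle_graph n) = (\<lambda>i. {i, (i + 1) mod n}) ` {..<n}"
    by (auto simp: cycle_graph_def)
  then have "(`) g ` edges (cycle_graph n) = (\<lambda>i. {g i, g ((i + 1) mod n)}) ` {..<n}" for g :: "nat \<Rightarrow> 'a"
    by (simp add: image_image)
  moreover have "verts (cycle_graph n) = {..<n}" by (simp add: cycle_graph_def)
  ultimately show ?thesis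
    using graph_isomorphic_iff_edges_image[OF assms(1) simple_graph_cycle_graph[OF assms(2)]]
    by simp
qed

lemma edges_eq_verts:
  assumes "simple_graph G" "edges G \<noteq> {}" "card (verts G) = 2"
  shows "edges G = {verts G}"
proof -
  have "e = verts G" if "e \<in> edges G" for e
    using that assms card_subset_eq[of "verts G" e] by (auto simp: simple_graph_def)
  then show ?thesis using assms(2) by auto
qed

lemma graph_isomorphic_K2_iff:
  assumes "simple_graph G" "edges G \<noteq> {}"
  shows "graph_isomorphic G (complete_graph 2) \<longleftrightarrow> card (verts G) = 2"
proof
  assume "graph_isomorphic G (complete_graph 2)"
  then show "card (verts G) = 2"
    by (auto simp: graph_isomorphic_def complete_graph_def dest: bij_betw_same_card)
next
  assume c: "card (verts G) = 2"
  have "\<exists>i j. {0, 1} = {i, j} \<and> i < 2 \<and> j < 2 \<and> i \<noteq> (j::nat)"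
    by (rule exI[of _ 0], rule exI[of _ 1]) simp
  then have "edges (complete_graph 2) \<noteq> {}"
    by (auto simp: complete_graph_def)
  then have K: "edges (complete_graph 2) = {{..<2}}"
    using edges_eq_verts[OF simple_graph_complete_graph, of 2] by (simp add: complete_graph_def)
  obtain g where g: "bij_betw g {..<2::nat} (verts G)"
    using c assms(1) by (metis card_lessThan finite_lessThan finite_same_card_bij simple_graph_def)
  then have "edges G = (`) g ` edges (complete_graph 2)"
    using edges_eq_verts[OF assms c] K by (simp add: bij_betw_def)
  then show "graph_isomorphic G (complete_graph 2)"
    using g graph_isomorphic_iff_edges_image[OF assms(1) simple_graph_complete_graph]
    by (auto simp: complete_graph_def)
qed

text \<open>
  In a longest path, every neighbor of the first vertex \<open>p\<^sub>0\<close> lies on the path. The second neighbor of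
  \<open>p\<^sub>0\<close> must be the last vertex, since an inner vertex adjacent to \<open>p\<^sub>0\<close> would have three neighbors.
  The path thus closes to a cycle, which already contains both neighbors of each of its vertices and
  so, by connectedness, is the whole graph.
\<close>

lemma two_regular_connected_is_cycle:
  assumes "simple_graph G" "connected_graph G" "\<forall>v\<in>verts G. degree G v = 2" and n: "n = card (verts G)"
  shows "\<exists>g. bij_betw g {..<n} (verts G) \<and> edges G = (\<lambda>i. {g i, g ((i + 1) mod n)}) ` {..<n}"
proof -
  let ?V = "verts G" and ?E = "edges G"
  have finV: "finite ?V" and simple: "\<And>e. e \<in> ?E \<Longrightarrow> e \<subseteq> ?V \<and> card e = 2"
    using assms(1) by (auto simp: simple_graph_def)
  have loop: "{v, v} \<notin> ?E" for v using simple[of "{v, v}"] by auto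
  define N where "N v = {w. {v, w} \<in> ?E}" for v
  have NV: "N v \<subseteq> ?V" for v using simple by (auto simp: N_def)
  have cardN: "card (N v) = 2" if "v \<in> ?V" for v
  proof -
    have "bij_betw (\<lambda>w. {v, w}) (N v) {e \<in> ?E. v \<in> e}"
      unfolding bij_betw_def
    proof
      show "inj_on (\<lambda>w. {v, w}) (N v)" by (auto simp: inj_on_def doubleton_eq_iff)
      show "(\<lambda>w. {v, w}) ` N v = {e \<in> ?E. v \<in> e}"
      proof (intro equalityI subsetI)
        fix e assume "e \<in> {e \<in> ?E. v \<in> e}"
        then have e: "e \<in> ?E" "v \<in> e" by auto
        then obtain w where "e = {v, w}"
          using simple[OF e(1)] by (auto simp: card_2_iff)
        then show "e \<in> (\<lambda>w. {v, w}) ` N v" using e(1) by (auto simp: N_def)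
      qed (auto simp: N_def)
    qed
    then show ?thesis
      using assms(3) that by (simp add: bij_betw_same_card degree_def)
  qed
  have finN: "finite (N v)" for v using NV finV finite_subset by blast
  define P where "P p \<longleftrightarrow> p \<noteq> [] \<and> distinct p \<and> set p \<subseteq> ?V \<and>
    (\<forall>i. Suc i < length p \<longrightarrow> {p ! i, p ! Suc i} \<in> ?E)" for p
  obtain v0 where "v0 \<in> ?V" using assms(2) by (auto simp: connected_graph_def)
  then have "P [v0]" by (simp add: P_def)
  moreover have "length p < Suc (card ?V)" if "P p" for p
    using that finV card_mono[of ?V "set p"] by (auto simp: P_def distinct_card less_Suc_eq_le)
  ultimately obtain p where p: "P p" and maxi: "\<And>q. P q \<Longrightarrow> length q \<le> length p"
    using ex_has_greatest_nat[of P "[v0]" length "Suc (card ?V)"] by blast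
  define m where "m = length p"
  have ne: "p \<noteq> []" and dist: "distinct p" and pV: "set p \<subseteq> ?V"
    and step: "\<And>i. Suc i < m \<Longrightarrow> {p ! i, p ! Suc i} \<in> ?E"
    using p by (auto simp: P_def m_def)
  have m0: "0 < m" using ne by (simp add: m_def)
  have idx: "p ! i = p ! j \<longleftrightarrow> i = j" if "i < m" "j < m" for i j
    using that dist by (simp add: m_def nth_eq_iff_index_eq)
  have inV: "p ! i \<in> ?V" if "i < m" for i using that pV by (auto simp: m_def)
  have start: "w \<in> set p" if w: "w \<in> N (p ! 0)" for w
  proof (rule ccontr)
    assume w': "w \<notin> set p"
    have "{(w # p) ! i, (w # p) ! Suc i} \<in> ?E" if "Suc i < length (w # p)" for i
    proof (cases i)
      case 0
      then show ?thesis using w by (simp add: N_def insert_commute)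
    next
      case (Suc l)
      then show ?thesis using step[of l] that by (simp add: m_def)
    qed
    then have "P (w # p)"
      using w' dist pV NV w by (auto simp: P_def)
    then show False using maxi[of "w # p"] by simp
  qed
  have "\<not> N (p ! 0) \<subseteq> {p ! 1}"
    using cardN[OF inV[OF m0]] card_mono[of "{p ! 1}" "N (p ! 0)"] by auto
  then obtain w where w: "w \<in> N (p ! 0)" "w \<noteq> p ! 1" by blast
  obtain j where j: "j < m" "w = p ! j"
    using start[OF w(1)] by (auto simp: in_set_conv_nth m_def)
  have "j \<noteq> 0" using w j(2) loop by (metis N_def mem_Collect_eq)
  moreover have "j \<noteq> 1" using w j by auto
  ultimately have j2: "j \<ge> 2" by simp
  have jm: "Suc j = m"
  proof (rule ccontr)
    assume "Suc j \<noteq> m"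
    then have sj: "Suc j < m" using j by simp
    have "{p ! 0, p ! (j - 1), p ! Suc j} \<subseteq> N (p ! j)"
      using w j step[OF sj] step[of "j - 1"] j2 by (auto simp: N_def insert_commute)
    then have "card {p ! 0, p ! (j - 1), p ! Suc j} \<le> 2"
      using cardN[OF inV[OF j(1)]] card_mono[OF finN] by metis
    moreover have "card {p ! 0, p ! (j - 1), p ! Suc j} = 3"
      using idx sj j2 by simp
    ultimately show False by simp
  qed
  have m3: "m \<ge> 3" using j2 jm by simp
  have cyc: "{p ! i, p ! (Suc i mod m)} \<in> ?E" if "i < m" for i
  proof (cases "Suc i = m")
    case True
    then have "i = j" using jm by simp
    then show ?thesis using w j jm by (simp add: N_def insert_commute)
  next
    case False
    then show ?thesis using step[of i] that by simp
  qed
  \<comment> \<open>the cyclic predecessor of an index\<close>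
  define pr where "pr i = (if i = 0 then m - 1 else i - 1)" for i
  have pr: "pr i < m" "Suc (pr i) mod m = i" if "i < m" for i
    using that by (auto simp: pr_def)
  have nbrs: "N (p ! i) = {p ! (Suc i mod m), p ! pr i}" if i: "i < m" for i
  proof -
    have "{p ! (Suc i mod m), p ! pr i} \<subseteq> N (p ! i)"
      using cyc[OF i] cyc[OF pr(1)[OF i]] pr(2)[OF i] by (auto simp: N_def insert_commute)
    moreover have "Suc i mod m \<noteq> pr i"
      using i m3 by (cases "Suc i = m") (auto simp: pr_def)
    then have "card {p ! (Suc i mod m), p ! pr i} = 2"
      using idx[of "Suc i mod m" "pr i"] pr(1)[OF i] m0 by simp
    ultimately show ?thesis
      using card_subset_eq[OF finN] cardN[OF inV[OF i]] by metis
  qed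
  have "v \<in> set p" if "(p ! 0, v) \<in> (adj_rel G)\<^sup>*" for v
    using that
  proof (induction rule: rtrancl_induct)
    case base
    then show ?case using ne by simp
  next
    case (step y z)
    then obtain i where i: "i < m" "y = p ! i" by (auto simp: in_set_conv_nth m_def)
    have "z \<in> N (p ! i)" using step i by (simp add: N_def adj_rel_def)
    then show ?case using nbrs[OF i(1)] pr(1)[OF i(1)] m0 by (auto simp: m_def)
  qed
  then have Vp: "?V = set p"
    using pV assms(2) inV[OF m0] unfolding connected_graph_def by blast
  then have mn: "m = n" using dist n by (simp add: distinct_card m_def)
  have "bij_betw ((!) p) {..<m} ?V"
    using bij_betw_nth[OF dist, of "{..<m}" ?V] Vp by (simp add: m_def)
  moreover have "?E = (\<lambda>i. {p ! i, p ! ((i + 1) mod m)}) ` {..<m}"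
  proof
    show "(\<lambda>i. {p ! i, p ! ((i + 1) mod m)}) ` {..<m} \<subseteq> ?E" using cyc by auto
    show "?E \<subseteq> (\<lambda>i. {p ! i, p ! ((i + 1) mod m)}) ` {..<m}"
    proof
      fix e assume e: "e \<in> ?E"
      then obtain u w where uw: "e = {u, w}" using simple by (metis card_2_iff)
      then have "u \<in> set p" using simple[OF e] Vp by auto
      then obtain i where i: "i < m" "u = p ! i" by (auto simp: in_set_conv_nth m_def)
      have "w \<in> N (p ! i)" using e uw i by (simp add: N_def)
      then consider "w = p ! (Suc i mod m)" | "w = p ! pr i" using nbrs[OF i(1)] by auto
      then show "e \<in> (\<lambda>i. {p ! i, p ! ((i + 1) mod m)}) ` {..<m}"
      proof cases
        case 1
        then show ?thesis using uw i by auto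
      next
        case 2
        then have "e = {p ! pr i, p ! ((pr i + 1) mod m)}" using uw i pr(2)[OF i(1)] by auto
        then show ?thesis using pr(1)[OF i(1)] by blast
      qed
    qed
  qed
  ultimately show ?thesis using mn by blast
qed

section \<open>Colorings of odd cycles and of paths\<close>

text \<open>
  The two colors alternate along the cycle. The edges number \<open>0\<close> and \<open>n - 1\<close> then have equal color, as
  \<open>n - 1\<close> is even, although they share the vertex \<open>g 0\<close>.
\<close>

lemma odd_cycle_not_2_colorable:
  fixes n :: nat
  assumes "odd n" "n \<ge> 3" "inj_on g {..<n}"
  shows "\<not> edge_coloring ((\<lambda>i. {g i, g ((i + 1) mod n)}) ` {..<n}) 2 c"
proof
  let ?e = "\<lambda>i. {g i, g ((i + 1) mod n)}"
  assume col: "edge_coloring (?e ` {..<n}) 2 c"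
  have idx: "g i = g j \<longleftrightarrow> i = j" if "i < n" "j < n" for i j
    using that assms(3) by (auto simp: inj_on_def)
  have consecutive: "c (?e i) \<noteq> c (?e ((i + 1) mod n))" if i: "i < n" for i
  proof -
    let ?j = "(i + 1) mod n" and ?k = "((i + 1) mod n + 1) mod n"
    have jk: "?j < n" "?k < n" "?k \<noteq> i" "?j \<noteq> i"
      using assms(2) i by (auto simp: mod_Suc)
    then have "g i \<notin> ?e ?j" using idx[of i ?j] idx[of i ?k] i by auto
    then have "?e i \<noteq> ?e ?j" by blast
    then show ?thesis
      using edge_coloring_eqD[OF col, of "?e i" "?e ?j" "g ?j"] i jk by blast
  qed
  have less2: "c (?e i) < 2" if "i < n" for i
    using edge_coloring_less[OF col] that by blast
  have "i < n \<Longrightarrow> c (?e i) = (c (?e 0) + i) mod 2" for i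
  proof (induction i)
    case 0
    then show ?case using less2[of 0] by simp
  next
    case (Suc i)
    then have "c (?e (Suc i)) \<noteq> c (?e i)" using consecutive[of i] by auto
    then show ?case
      using Suc less2[of i] less2[of "Suc i"] by (simp add: mod_Suc)
  qed
  from this[of "n - 1"] have "c (?e (n - 1)) = c (?e 0)"
    using assms(1,2) less2[of 0] by (auto elim!: oddE)
  then show False using consecutive[of "n - 1"] assms(2) by simp
qed

lemma path_2_colorable:
  assumes "inj_on g {..n}"
  shows "\<exists>c. edge_coloring ((\<lambda>i. {g i, g (Suc i)}) ` {..<n}) 2 c"
proof -
  let ?e = "\<lambda>i. {g i, g (Suc i)}"
  \<comment> \<open>The color of an edge is the parity of the position of its first end.\<close>
  define c where "c f = (LEAST i. g i \<in> f \<and> i \<le> n) mod 2" for f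
  have idx: "g i = g j \<longleftrightarrow> i = j" if "i \<le> n" "j \<le> n" for i j
    using that assms by (auto simp: inj_on_def)
  have c: "c (?e i) = i mod 2" if "i < n" for i
  proof -
    have "(LEAST j. g j \<in> ?e i \<and> j \<le> n) = i"
      by (rule Least_equality) (use that idx in auto)
    then show ?thesis by (simp only: c_def)
  qed
  have "edge_coloring (?e ` {..<n}) 2 c"
    unfolding edge_coloring_def
  proof (intro conjI ballI impI)
    fix e f assume "e \<in> ?e ` {..<n}" "f \<in> ?e ` {..<n}" and ef: "e \<noteq> f" "e \<inter> f \<noteq> {}"
    then obtain i j where ij: "i < n" "j < n" "e = ?e i" "f = ?e j" by blast
    then have "i \<noteq> j" using ef(1) by auto
    then have "i = Suc j \<or> j = Suc i" using ef(2) ij idx by auto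
    then have "i mod 2 \<noteq> j mod 2" by presburger
    then show "c e \<noteq> c f" using c[OF ij(1)] c[OF ij(2)] ij(3,4) by simp
  qed (auto simp: c)
  then show ?thesis by blast
qed

section \<open>Regular graphs of stability index one\<close>

theorem theorem3p8:
  fixes G :: "'a ugraph"
  assumes "simple_graph G"
    and "edges G \<noteq> {}"
    and "connected_graph G"
    and "regular_graph G"
  shows "chromatic_edge_stability_index G = 1 \<longleftrightarrow>
    graph_isomorphic G (complete_graph 2) \<or>
    (\<exists>n\<ge>3. odd n \<and> graph_isomorphic G (cycle_graph n))"
proof -
  let ?V = "verts G" and ?E = "edges G"
  have finV: "finite ?V" and simple: "\<forall>e\<in>?E. e \<subseteq> ?V \<and> card e = 2"
    using assms(1) by (auto simp: simple_graph_def)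
  have finE: "finite ?E" using finite_edges[OF assms(1)] .
  obtain r where deg: "\<And>v. v \<in> ?V \<Longrightarrow> card {e \<in> ?E. v \<in> e} = r"
    using assms(4) by (auto simp: regular_graph_def degree_def)
  show ?thesis
    unfolding chromatic_edge_stability_index_eq_1_iff[OF assms(1,2)]
  proof
    assume "\<exists>e\<in>?E. \<exists>k. (\<exists>c. edge_coloring (?E - {e}) k c) \<and> \<not> (\<exists>c. edge_coloring ?E k c)"
    then obtain e k c where e: "e \<in> ?E" and c: "edge_coloring (?E - {e}) k c"
      and not_k: "\<not> (\<exists>c. edge_coloring ?E k c)" by blast
    have "k \<le> r"
      using vizing_extension[OF finV simple _ e c] deg not_k by (metis leI)
    show "graph_isomorphic G (complete_graph 2) \<or>
      (\<exists>n\<ge>3. odd n \<and> graph_isomorphic G (cycle_graph n))"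
    proof (cases "\<exists>c'. edge_coloring ?E r c'")
      case True
      then have "k < r" using \<open>k \<le> r\<close> not_k by (metis le_neq_implies_less)
      have "v \<in> e" if "v \<in> ?V" for v
      proof (rule ccontr)
        assume "v \<notin> e"
        then have "{f \<in> ?E - {e}. v \<in> f} = {f \<in> ?E. v \<in> f}" by auto
        then have "r \<le> k"
          using card_missing_colors[OF _ c, of v] deg[OF that] finE by simp
        then show False using \<open>k < r\<close> by simp
      qed
      then have "?V = e" using simple e by blast
      then have "card ?V = 2" using simple e by simp
      then show ?thesis using graph_isomorphic_K2_iff[OF assms(1,2)] by blast
    next
      case False
      then have r: "r = 2" and odd: "odd (card ?V)"
        using regular_critical_edge[OF finV simple deg e edge_coloring_mono[OF c \<open>k \<le> r\<close>]] by auto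
      have "2 \<le> card ?V" using simple e finV card_mono by metis
      then have n3: "card ?V \<ge> 3" using odd by (cases "card ?V = 2") auto
      have "graph_isomorphic G (cycle_graph (card ?V))"
        unfolding graph_isomorphic_cycle_graph_iff[OF assms(1) n3]
        using two_regular_connected_is_cycle[OF assms(1,3) _ refl] deg r
        by (simp add: degree_def)
      then show ?thesis using n3 odd by blast
    qed
  next
    assume "graph_isomorphic G (complete_graph 2) \<or>
      (\<exists>n\<ge>3. odd n \<and> graph_isomorphic G (cycle_graph n))"
    then show "\<exists>e\<in>?E. \<exists>k. (\<exists>c. edge_coloring (?E - {e}) k c) \<and> \<not> (\<exists>c. edge_coloring ?E k c)"
    proof (elim disjE exE conjE)
      assume "graph_isomorphic G (complete_graph 2)"
      then have "?E = {?V}"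
        using graph_isomorphic_K2_iff[OF assms(1,2)] edges_eq_verts[OF assms(1,2)] by blast
      then have "edge_coloring (?E - {?V}) 0 c" "\<not> edge_coloring ?E 0 c" for c
        by (auto simp: edge_coloring_def)
      then show ?thesis using \<open>?E = {?V}\<close> by blast
    next
      fix n assume n: "3 \<le> n" "odd n" and "graph_isomorphic G (cycle_graph n)"
      then obtain g where g: "bij_betw g {..<n} ?V"
        and E: "?E = (\<lambda>i. {g i, g ((i + 1) mod n)}) ` {..<n}"
        using graph_isomorphic_cycle_graph_iff[OF assms(1)] by blast
      have inj: "inj_on g {..<n}" using g by (simp add: bij_betw_def)
      let ?e = "\<lambda>i. {g i, g ((i + 1) mod n)}"
      have "?E - {?e (n - 1)} \<subseteq> (\<lambda>i. {g i, g (Suc i)}) ` {..<n - 1}"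
      proof
        fix f assume f: "f \<in> ?E - {?e (n - 1)}"
        then obtain i where i: "i < n" "f = ?e i" using E by blast
        then have "i \<noteq> n - 1" using f by blast
        then have "i < n - 1" using i by simp
        then show "f \<in> (\<lambda>i. {g i, g (Suc i)}) ` {..<n - 1}" using i by auto
      qed
      moreover have "inj_on g {..n - 1}"
        by (rule inj_on_subset[OF inj]) (use n in auto)
      from path_2_colorable[OF this]
      obtain c where "edge_coloring ((\<lambda>i. {g i, g (Suc i)}) ` {..<n - 1}) 2 c" by (elim exE)
      ultimately have "edge_coloring (?E - {?e (n - 1)}) 2 c"
        by (rule edge_coloring_subset[rotated])
      then have "\<exists>c. edge_coloring (?E - {?e (n - 1)}) 2 c"
        by - (rule exI)
      moreover have "\<not> (\<exists>c. edge_coloring ?E 2 c)"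
        unfolding E using odd_cycle_not_2_colorable[OF n(2,1) inj] by simp
      moreover have "?e (n - 1) \<in> ?E" unfolding E by (rule imageI) (use n in auto)
      ultimately show ?thesis by (intro bexI[of _ "?e (n - 1)"] exI[of _ 2] conjI)
    qed
  qed
qed

end
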